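(* Let $(\mathcal{H},d)$ be an Hadamard space, let $F\colon\mathcal{H}\to\mathcal{H}$ be a nonexpansive mapping with resolvents $R_\lambda$, $\lambda\in(0,\infty)$, and let $x\in\mathcal{H}$. If there exists a sequence $(\lambda_n)\subset(0,\infty)$ such that $\lambda_n\to\infty$ and the sequence $(R_{\lambda_n}x)_{n\in\mathbb{N}}$ is bounded, then $\operatorname{Fix}F$ is nonempty and $$\lim_{\lambda\to\infty}R_\lambda x=P_{\operatorname{Fix}F}(x).$$ Conversely, if $\operatorname{Fix}F\neq\emptyset$, then the curve $(R_\lambda x)_{\lambda\in(0,\infty)}$ is bounded.
   Context: An Hadamard space $(\mathcal{H},d)$ is a complete geodesic metric space satisfying $$d(x,\gamma_t)^2\le(1-t)d(x,\gamma_0)^2+t\,d(x,\gamma_1)^2-t(1-t)d(\gamma_0,\gamma_1)^2$$ for any $x\in\mathcal{H}$, any geodesic $\gamma\colon[0,1]\to\mathcal{H}$ and any $t\in[0,1]$. Any two points $x,y\in\mathcal{H}$ are joined by a unique geodesic, and for $t\in[0,1]$ one writes $(1-t)x+ty$ for the point $z$ on this geodesic with $d(x,z)=t\,d(x,y)$ and $d(z,y)=(1-t)d(x,y)$. A mapping $F\colon\mathcal{H}\to\mathcal{H}$ is nonexpansive if $d(Fx,Fy)\le d(x,y)$ for all $x,y\in\mathcal{H}$; $\operatorname{Fix}F=\{x\in\mathcal{H}\colon Fx=x\}$. Resolvent: for $x\in\mathcal{H}$ and $\lambda>0$, the mapping $G_{x,\lambda}\colon\mathcal{H}\to\mathcal{H}$,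 $G_{x,\lambda}(y)=\frac{1}{1+\lambda}x+\frac{\lambda}{1+\lambda}Fy$, is a strict contraction with Lipschitz constant $\frac{\lambda}{1+\lambda}$, and $R_\lambda x$ denotes its unique fixed point. The mapping $x\mapsto R_\lambda x$ is the resolvent of $F$. For a nonempty closed convex set $C\subset\mathcal{H}$, $P_C(x)$ denotes the metric projection of $x$ onto $C$, i.e. the unique point $c\in C$ with $d(x,c)=\inf_{y\in C}d(x,y)$. (The fixed point set of a nonexpansive mapping on an Hadamard space is closed and convex.) *)

theory Defs
  imports "HOL-Analysis.Analysis"
begin

text \<open>Geodesics are parametrised proportionally to arc length on \<open>[0,1]\<close>; values outside
  \<open>[0,1]\<close> are irrelevant.\<close>

definition (in metric_space) geodesic :: "(real \<Rightarrow> 'a) \<Rightarrow> bool" where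
  "geodesic g \<longleftrightarrow>
     (\<forall>s\<in>{0..1}. \<forall>t\<in>{0..1}. dist (g s) (g t) = \<bar>s - t\<bar> * dist (g 0) (g 1))"

class hadamard_space = complete_space +
  assumes geodesic_exists: "\<exists>g. geodesic g \<and> g 0 = x \<and> g 1 = y"
    and CN_inequality: "geodesic g \<Longrightarrow> 0 \<le> t \<Longrightarrow> t \<le> 1 \<Longrightarrow>
      (dist x (g t))\<^sup>2 \<le> (1 - t) * (dist x (g 0))\<^sup>2 + t * (dist x (g 1))\<^sup>2
        - t * (1 - t) * (dist (g 0) (g 1))\<^sup>2"

text \<open>\<open>geodesic_comb t x y\<close> is the point written \<open>(1 - t) x + t y\<close>.\<close>

definition geodesic_comb :: "real \<Rightarrow> 'a::hadamard_space \<Rightarrow> 'a \<Rightarrow> 'a" where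
  "geodesic_comb t x y = (THE z. \<exists>g. geodesic g \<and> g 0 = x \<and> g 1 = y \<and> z \<in> g ` {0..1} \<and>
     dist x z = t * dist x y \<and> dist z y = (1 - t) * dist x y)"

definition nonexpansive :: "('a::metric_space \<Rightarrow> 'a) \<Rightarrow> bool" where
  "nonexpansive F \<longleftrightarrow> (\<forall>x y. dist (F x) (F y) \<le> dist x y)"

definition Fix :: "('a \<Rightarrow> 'a) \<Rightarrow> 'a set" where
  "Fix F = {x. F x = x}"

text \<open>Since \<open>1 - l / (1 + l) = 1 / (1 + l)\<close>, the following is the map
  \<open>G\<^bsub>x,l\<^esub>(y) = 1 / (1 + l) x + l / (1 + l) F y\<close>.\<close>

definition resolvent_map :: "('a::hadamard_space \<Rightarrow> 'a) \<Rightarrow> 'a \<Rightarrow> real \<Rightarrow> 'a \<Rightarrow> 'a" where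
  "resolvent_map F x l y = geodesic_comb (l / (1 + l)) x (F y)"

definition resolvent :: "('a::hadamard_space \<Rightarrow> 'a) \<Rightarrow> real \<Rightarrow> 'a \<Rightarrow> 'a" where
  "resolvent F l x = (THE y. resolvent_map F x l y = y)"

definition metric_projection :: "'a::metric_space set \<Rightarrow> 'a \<Rightarrow> 'a" where
  "metric_projection C x = (THE c. c \<in> C \<and> dist x c = infdist x C)"

text \<open>The definite descriptions in \<open>geodesic_comb\<close> and \<open>resolvent\<close> are well defined.\<close>

lemma geodesic_comb_unique:
  fixes x y z w :: "'a::hadamard_space"
  assumes t: "0 \<le> t" "t \<le> 1"
    and z: "dist x z = t * dist x y" "dist z y = (1 - t) * dist x y"
    and g: "geodesic g" "g 0 = x" "g 1 = y"
  shows "z = g t"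
proof -
  have "(dist z (g t))\<^sup>2 \<le> (1 - t) * (dist z x)\<^sup>2 + t * (dist z y)\<^sup>2 - t * (1 - t) * (dist x y)\<^sup>2"
    using CN_inequality[OF g(1) t, of z] g by simp
  also have "\<dots> = 0"
    unfolding z(2) dist_commute[of z x] z(1) by (simp add: power2_eq_square algebra_simps)
  finally show ?thesis by simp
qed

lemma geodesic_comb_eq:
  fixes x y :: "'a::hadamard_space"
  assumes t: "0 \<le> t" "t \<le> 1" and g: "geodesic g" "g 0 = x" "g 1 = y"
  shows "geodesic_comb t x y = g t"
    and "dist x (g t) = t * dist x y" and "dist (g t) y = (1 - t) * dist x y"
proof -
  have d: "dist (g s) (g r) = \<bar>s - r\<bar> * dist x y" if "s \<in> {0..1}" "r \<in> {0..1}" for s r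
    using g that unfolding geodesic_def by blast
  show 1: "dist x (g t) = t * dist x y"
    using d[of 0 t] t g by simp
  show 2: "dist (g t) y = (1 - t) * dist x y"
    using d[of t 1] t g by simp
  show "geodesic_comb t x y = g t"
    unfolding geodesic_comb_def
  proof (rule the_equality)
    show "\<exists>h. geodesic h \<and> h 0 = x \<and> h 1 = y \<and> g t \<in> h ` {0..1} \<and>
      dist x (g t) = t * dist x y \<and> dist (g t) y = (1 - t) * dist x y"
      using g t 1 2 by (intro exI[of _ g]) auto
  qed (use geodesic_comb_unique[OF t _ _ g] in blast)
qed

lemma geodesic_comb_contraction:
  fixes x u v :: "'a::hadamard_space"
  assumes t: "0 \<le> t" "t \<le> 1"
  shows "dist (geodesic_comb t x u) (geodesic_comb t x v) \<le> t * dist u v"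
proof -
  obtain g where g: "geodesic g" "g 0 = x" "g 1 = u" using geodesic_exists by blast
  obtain h where h: "geodesic h" "h 0 = x" "h 1 = v" using geodesic_exists by blast
  let ?p = "g t"
  have "(dist ?p (h t))\<^sup>2 \<le> (1 - t) * (dist ?p x)\<^sup>2 + t * (dist ?p v)\<^sup>2 - t * (1 - t) * (dist x v)\<^sup>2"
    using CN_inequality[OF h(1) t, of ?p] h by simp
  also have "(dist ?p x)\<^sup>2 = t\<^sup>2 * (dist x u)\<^sup>2"
    using geodesic_comb_eq(2)[OF t g] by (simp add: dist_commute power_mult_distrib)
  also have "t * (dist ?p v)\<^sup>2 \<le>
      t * ((1 - t) * (dist x v)\<^sup>2 + t * (dist u v)\<^sup>2 - t * (1 - t) * (dist x u)\<^sup>2)"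
    using CN_inequality[OF g(1) t, of v] g t(1) by (intro mult_left_mono) (simp_all add: dist_commute)
  finally have "(dist ?p (h t))\<^sup>2 \<le> (t * dist u v)\<^sup>2"
    by (simp add: power2_eq_square algebra_simps)
  then have "dist ?p (h t) \<le> t * dist u v"
    using t by (auto intro: power2_le_imp_le)
  then show ?thesis
    using geodesic_comb_eq(1)[OF t g] geodesic_comb_eq(1)[OF t h] by simp
qed

lemma resolvent_unique:
  fixes F :: "'a::hadamard_space \<Rightarrow> 'a"
  assumes F: "nonexpansive F" and l: "0 < l"
  shows "\<exists>!y. resolvent_map F x l y = y"
proof -
  have c: "0 \<le> l / (1 + l)" "l / (1 + l) < 1" using l by (auto simp: field_simps)
  have "dist (resolvent_map F x l y) (resolvent_map F x l z) \<le> l / (1 + l) * dist y z" for y z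
  proof -
    have "dist (resolvent_map F x l y) (resolvent_map F x l z) \<le> l / (1 + l) * dist (F y) (F z)"
      unfolding resolvent_map_def using c by (intro geodesic_comb_contraction) auto
    also have "\<dots> \<le> l / (1 + l) * dist y z"
      using F c unfolding nonexpansive_def by (intro mult_left_mono) auto
    finally show ?thesis .
  qed
  then show ?thesis
    using banach_fix_type[OF c, of "resolvent_map F x l"] by blast
qed

end

theory Submission
  imports Defs
begin

text \<open>Put \<open>t = l / (1 + l)\<close> and \<open>h l = d(x, R\<^sub>l x)\<^sup>2 / t\<close>. Applying the CN inequality to the
  two geodesics that define \<open>R\<^sub>l x\<close> and \<open>R\<^sub>m x\<close>, \<open>l \<le> m\<close>, gives
  \<open>d(R\<^sub>l x, R\<^sub>m x)\<^sup>2 \<le> h m - h l\<close>. So \<open>h\<close> is nondecreasing, and once it is bounded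
  the curve is Cauchy; as \<open>d(R\<^sub>l x, F (R\<^sub>l x)) = d(x, R\<^sub>l x) / l\<close>, its limit is a fixed point.
  The same computation with a fixed point \<open>q\<close> in place of \<open>R\<^sub>m x\<close> gives
  \<open>d(R\<^sub>l x, q)\<^sup>2 \<le> d(x, q)\<^sup>2 - h l\<close>, which bounds the curve and, in the limit, identifies
  the projection.\<close>

lemma geodesic_comb_dist:
  fixes x y :: "'a::hadamard_space"
  assumes "0 \<le> t" "t \<le> 1"
  shows "dist x (geodesic_comb t x y) = t * dist x y"
    and "dist (geodesic_comb t x y) y = (1 - t) * dist x y"
proof -
  obtain g where "geodesic g" "g 0 = x" "g 1 = y" using geodesic_exists by blast
  then show "dist x (geodesic_comb t x y) = t * dist x y"
    and "dist (geodesic_comb t x y) y = (1 - t) * dist x y"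
    using geodesic_comb_eq[OF assms] by metis+
qed

lemma geodesic_comb_CN:
  fixes w x y :: "'a::hadamard_space"
  assumes "0 \<le> t" "t \<le> 1"
  shows "(dist w (geodesic_comb t x y))\<^sup>2 \<le>
    (1 - t) * (dist w x)\<^sup>2 + t * (dist w y)\<^sup>2 - t * (1 - t) * (dist x y)\<^sup>2"
proof -
  obtain g where g: "geodesic g" "g 0 = x" "g 1 = y" using geodesic_exists by blast
  show ?thesis
    using CN_inequality[OF g(1) assms, of w] geodesic_comb_eq(1)[OF assms g] g by simp
qed

text \<open>With \<open>u = F r\<close> and \<open>v = F s\<close>, the hypothesis on distances is nonexpansiveness; \<open>b = 1\<close>
  is the case where \<open>s = v\<close> is a fixed point.\<close>

lemma geodesic_comb_dist_le:
  fixes a b :: real and x u v :: "'a::hadamard_space"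
  defines "r \<equiv> geodesic_comb a x u" and "s \<equiv> geodesic_comb b x v"
  assumes ab: "0 < a" "a < 1" "a \<le> b" "b \<le> 1"
    and uv: "dist u v \<le> dist r s"
  shows "(dist r s)\<^sup>2 \<le> (dist x s)\<^sup>2 / b - (dist x r)\<^sup>2 / a"
proof -
  define A B D where "A = (dist x u)\<^sup>2" and "B = (dist x v)\<^sup>2" and "D = (dist r s)\<^sup>2"
  have xs: "dist x s = b * dist x v" and xr: "dist x r = a * dist x u"
    unfolding r_def s_def using ab by (auto intro: geodesic_comb_dist(1))
  have sx: "(dist x s)\<^sup>2 = b\<^sup>2 * B" and rx: "(dist x r)\<^sup>2 = a\<^sup>2 * A"
    unfolding xs xr A_def B_def by (simp_all only: power_mult_distrib)
  \<comment> \<open>The CN inequality is used twice: for \<open>s\<close> against the segment from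
    \<open>x\<close> to \<open>u\<close>, then for \<open>u\<close> against the segment from
    \<open>x\<close> to \<open>v\<close>. The second bounds \<open>dist s u\<close> and brings back
    \<open>D\<close> with total factor \<open>a * b < 1\<close>, so it can be absorbed on the
    left.\<close>
  have "(dist s r)\<^sup>2 \<le> (1 - a) * (dist s x)\<^sup>2 + a * (dist s u)\<^sup>2 - a * (1 - a) * A"
    unfolding r_def A_def using ab by (intro geodesic_comb_CN) auto
  then have D: "D \<le> (1 - a) * (b\<^sup>2 * B) + a * (dist s u)\<^sup>2 - a * (1 - a) * A"
    unfolding D_def dist_commute[of s r] dist_commute[of s x] sx .
  have "(dist u s)\<^sup>2 \<le> (1 - b) * (dist u x)\<^sup>2 + b * (dist u v)\<^sup>2 - b * (1 - b) * B"
    unfolding s_def B_def using ab by (intro geodesic_comb_CN) auto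
  moreover have "b * (dist u v)\<^sup>2 \<le> b * D"
    unfolding D_def using ab uv by (intro mult_left_mono power_mono) auto
  ultimately have su: "(dist s u)\<^sup>2 \<le> (1 - b) * A + b * D - b * (1 - b) * B"
    unfolding A_def dist_commute[of s u] dist_commute[of x u] by linarith
  have "D \<le> (1 - a) * (b\<^sup>2 * B) + a * ((1 - b) * A + b * D - b * (1 - b) * B) - a * (1 - a) * A"
    using D mult_left_mono[OF su, of a] ab by linarith
  then have main: "(1 - a * b) * D \<le> (b - a) * (b * B - a * A)"
    by (simp add: algebra_simps power2_eq_square)
  have "a * b < 1" using ab mult_left_mono[of b 1 a] by linarith
  have "0 \<le> D" by (simp add: D_def)
  \<comment> \<open>The difference of the two sides is \<open>(1 - b) * (1 + a)\<close>.\<close>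
  have le: "b - a \<le> 1 - a * b"
    using mult_nonneg_nonneg[of "1 - b" "1 + a"] ab by (simp add: algebra_simps)
  have "D \<le> b * B - a * A"
  \<comment> \<open>For \<open>a < b\<close> the factor \<open>b - a\<close> cancels from
    \<open>main\<close>. For \<open>a = b\<close> it vanishes, but then \<open>main\<close> forces
    \<open>r = s\<close>, and both sides of the claim are zero.\<close>
  proof (cases "a = b")
    case True
    then have "(1 - a * b) * D \<le> 0" using main by simp
    then have "D \<le> 0" using \<open>a * b < 1\<close> by (simp add: mult_le_0_iff)
    moreover have "s = r" if "D = 0" using that by (simp add: D_def)
    ultimately have "D = 0" "a\<^sup>2 * A = b\<^sup>2 * B" using \<open>0 \<le> D\<close> sx rx by auto
    then show ?thesis using True ab by simp
  next
    case False
    then have "0 < b - a" using ab by simp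
    moreover have "(b - a) * D \<le> (b - a) * (b * B - a * A)"
      using main mult_right_mono[OF le \<open>0 \<le> D\<close>] by linarith
    ultimately show ?thesis by simp
  qed
  then show ?thesis
    using ab unfolding sx rx D_def by (simp add: power2_eq_square)
qed

text \<open>The function \<open>h\<close> is nondecreasing and bounded above, so its increments
  become small, and they dominate the squared distances along the curve.\<close>

lemma tendsto_at_top_of_dist_le_increment:
  fixes f :: "real \<Rightarrow> 'a::complete_space" and h :: "real \<Rightarrow> real"
  assumes incr: "\<And>l m. 0 < l \<Longrightarrow> l \<le> m \<Longrightarrow> (dist (f l) (f m))\<^sup>2 \<le> h m - h l"
    and bdd: "\<And>l. 0 < l \<Longrightarrow> h l \<le> K"
  shows "\<exists>p. (f \<longlongrightarrow> p) at_top"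
proof -
  have "bdd_above (h ` {0<..})"
    using bdd by (intro bdd_aboveI[of _ K]) auto
  have tail: "\<exists>k>0. \<forall>m\<ge>k. dist (f k) (f m) < e" if "0 < e" for e
  proof -
    \<comment> \<open>Take \<open>k\<close> with \<open>h k\<close> within \<open>e\<^sup>2\<close>
      of the supremum; from \<open>k\<close> on, no increment of \<open>h\<close> reaches
      \<open>e\<^sup>2\<close>.\<close>
    have "\<exists>y\<in>h ` {0<..}. Sup (h ` {0<..}) - e\<^sup>2 < y"
      using that by (intro less_cSupD) auto
    then obtain k where k: "0 < k" "Sup (h ` {0<..}) - e\<^sup>2 < h k" by auto
    have "dist (f k) (f m) < e" if "k \<le> m" for m
    proof -
      have "h m \<le> Sup (h ` {0<..})"
        using \<open>bdd_above _\<close> k that by (intro cSup_upper) auto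
      then have "(dist (f k) (f m))\<^sup>2 < e\<^sup>2"
        using incr[OF k(1) that] k(2) by linarith
      then show ?thesis using \<open>0 < e\<close> by (auto intro: power2_less_imp_less)
    qed
    then show ?thesis using k(1) by blast
  qed
  \<comment> \<open>Completeness speaks of sequences, so the limit is found along the integers and
    \<open>tail\<close> then extends it to real parameters.\<close>
  have "Cauchy (\<lambda>n. f (real n))"
    unfolding Cauchy_altdef2
  proof (intro allI impI)
    fix e :: real assume "0 < e"
    then obtain k where k: "\<forall>m\<ge>k. dist (f k) (f m) < e / 2" using tail[of "e / 2"] by auto
    obtain N where N: "k \<le> real N" using real_arch_simple by blast
    have "dist (f (real n)) (f (real N)) < e" if "N \<le> n" for n
    proof (rule dist_triangle_half_r)
      have "k \<le> real n" using N of_nat_mono[OF that, where 'a = real] by linarith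
      then show "dist (f k) (f (real n)) < e / 2" using k by blast
      show "dist (f k) (f (real N)) < e / 2" using k N by blast
    qed
    then show "\<exists>N. \<forall>n\<ge>N. dist (f (real n)) (f (real N)) < e" by blast
  qed
  then obtain p where p: "(\<lambda>n. f (real n)) \<longlonglongrightarrow> p"
    using Cauchy_convergent convergentD by blast
  have "(f \<longlongrightarrow> p) at_top"
  proof (rule tendstoI)
    fix e :: real assume "0 < e"
    then obtain k where k: "\<forall>m\<ge>k. dist (f k) (f m) < e / 2" using tail[of "e / 2"] by auto
    have "(\<lambda>n. dist (f k) (f (real n))) \<longlonglongrightarrow> dist (f k) p"
      by (intro tendsto_intros p)
    moreover have "\<forall>\<^sub>F n in sequentially. dist (f k) (f (real n)) \<le> e / 2"
      using eventually_ge_at_top[of "nat \<lceil>k\<rceil>"]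
    proof eventually_elim
      case (elim n)
      then have "k \<le> real n" by (simp add: nat_ceiling_le_eq)
      then show ?case using k by (blast intro: less_imp_le)
    qed
    ultimately have "dist (f k) p \<le> e / 2"
      by (intro tendsto_upperbound) auto
    have "dist (f m) p < e" if "k \<le> m" for m
    proof -
      have "dist (f k) (f m) < e / 2" using k that by blast
      then show ?thesis
        using \<open>dist (f k) p \<le> e / 2\<close> dist_triangle3[of "f m" p "f k"] by linarith
    qed
    then show "\<forall>\<^sub>F m in at_top. dist (f m) p < e"
      by (auto simp: eventually_at_top_linorder)
  qed
  then show ?thesis by blast
qed

context
  fixes F :: "'a::hadamard_space \<Rightarrow> 'a" and x :: 'a
  assumes F: "nonexpansive F"
begin

lemma resolvent_eq:
  assumes "0 < l"
  shows "geodesic_comb (l / (1 + l)) x (F (resolvent F l x)) = resolvent F l x"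
  using theI'[OF resolvent_unique[OF F assms, of x]]
  unfolding resolvent_def resolvent_map_def .

text \<open>The weight \<open>l / (1 + l)\<close> makes the resolvent divide the segment from
  \<open>x\<close> to its image under \<open>F\<close> in the ratio \<open>l : 1\<close>.\<close>

lemma dist_resolvent_image:
  assumes "0 < l"
  shows "dist (resolvent F l x) (F (resolvent F l x)) = dist x (resolvent F l x) / l"
proof -
  have "0 \<le> l / (1 + l)" "l / (1 + l) \<le> 1" "1 - l / (1 + l) = 1 / (1 + l)"
    using assms by (auto simp: field_simps)
  from geodesic_comb_dist[OF this(1,2), of x "F (resolvent F l x)"] this(3)
  show ?thesis
    unfolding resolvent_eq[OF assms] using assms by simp
qed

lemma dist_resolvents_le:
  assumes "0 < l" "l \<le> m"
  shows "(dist (resolvent F l x) (resolvent F m x))\<^sup>2 \<le>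
    (dist x (resolvent F m x))\<^sup>2 / (m / (1 + m)) - (dist x (resolvent F l x))\<^sup>2 / (l / (1 + l))"
proof -
  have "l / (1 + l) \<le> m / (1 + m)" using assms by (simp add: field_simps)
  moreover have "dist (F (resolvent F l x)) (F (resolvent F m x)) \<le>
      dist (resolvent F l x) (resolvent F m x)"
    using F by (simp add: nonexpansive_def)
  ultimately show ?thesis
    using geodesic_comb_dist_le[of "l / (1 + l)" "m / (1 + m)"
        "F (resolvent F l x)" "F (resolvent F m x)" x]
      resolvent_eq[of l] resolvent_eq[of m] assms by simp
qed

lemma dist_resolvent_Fix_le:
  assumes "0 < l" "q \<in> Fix F"
  shows "(dist (resolvent F l x) q)\<^sup>2 \<le>
    (dist x q)\<^sup>2 - (dist x (resolvent F l x))\<^sup>2 / (l / (1 + l))"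
proof -
  have "geodesic_comb 1 x q = q"
    using geodesic_comb_dist(2)[of 1 x q] by simp
  moreover have "dist (F (resolvent F l x)) q \<le> dist (resolvent F l x) q"
    using F[unfolded nonexpansive_def, rule_format, of "resolvent F l x" q] assms(2)
    by (simp add: Fix_def)
  ultimately show ?thesis
    using geodesic_comb_dist_le[of "l / (1 + l)" 1 "F (resolvent F l x)" q x]
      resolvent_eq[of l] assms by simp
qed

text \<open>The weight lies in \<open>(0, 1)\<close>. This removes it from the estimates against
  fixed points.\<close>

lemma sq_dist_resolvent_le:
  assumes "0 < l"
  shows "(dist x (resolvent F l x))\<^sup>2 \<le> (dist x (resolvent F l x))\<^sup>2 / (l / (1 + l))"
  using assms by (simp add: field_simps)

text \<open>Nonexpansiveness puts \<open>F p\<close> within d(R, F R) + d(R, p) of the resolvent R,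
  and both terms tend to 0, the first because d(x, R) converges while it is divided by
  \<open>l\<close>.\<close>

lemma limit_resolvent_in_Fix:
  assumes p: "((\<lambda>l. resolvent F l x) \<longlongrightarrow> p) at_top"
  shows "p \<in> Fix F"
proof -
  have "((\<lambda>l. dist x (resolvent F l x) / l) \<longlongrightarrow> 0) at_top"
    by (intro tendsto_divide_0[OF tendsto_dist[OF tendsto_const p]]
        filterlim_mono[OF filterlim_ident at_top_le_at_infinity order_refl])
  moreover have "\<forall>\<^sub>F l in at_top. dist x (resolvent F l x) / l =
      dist (resolvent F l x) (F (resolvent F l x))"
    using eventually_gt_at_top[of 0] by eventually_elim (simp add: dist_resolvent_image)
  ultimately have "((\<lambda>l. dist (resolvent F l x) (F (resolvent F l x))) \<longlongrightarrow> 0) at_top"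
    by (rule Lim_transform_eventually)
  moreover have "((\<lambda>l. dist (resolvent F l x) p) \<longlongrightarrow> 0) at_top"
    by (rule tendsto_dist_iff[THEN iffD1, OF p])
  ultimately have sum: "((\<lambda>l. dist (resolvent F l x) (F (resolvent F l x)) +
      dist (resolvent F l x) p) \<longlongrightarrow> 0 + 0) at_top"
    by (rule tendsto_add)
  have le: "dist (F p) (resolvent F l x) \<le>
      dist (resolvent F l x) (F (resolvent F l x)) + dist (resolvent F l x) p" for l
    using F[unfolded nonexpansive_def, rule_format, of "resolvent F l x" p]
      dist_triangle3[of "F p" "resolvent F l x" "F (resolvent F l x)"]
    unfolding dist_commute[of "resolvent F l x" "F (resolvent F l x)"] by linarith
  have lim: "((\<lambda>l. dist (F p) (resolvent F l x)) \<longlongrightarrow> dist (F p) p) at_top"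
    by (intro tendsto_intros p)
  have "dist (F p) p \<le> 0 + 0"
    by (rule tendsto_le[OF trivial_limit_at_top_linorder sum lim]) (simp add: le)
  then show ?thesis by (simp add: Fix_def)
qed

lemma limit_resolvent_eq_projection:
  assumes p: "((\<lambda>l. resolvent F l x) \<longlongrightarrow> p) at_top"
  shows "p = metric_projection (Fix F) x"
proof -
  have pF: "p \<in> Fix F" by (rule limit_resolvent_in_Fix[OF p])
  \<comment> \<open>This Pythagorean inequality yields both properties of the projection: a
    nonnegative left side makes \<open>p\<close> a nearest fixed point, and for another nearest
    \<open>q\<close> the right side is zero, so \<open>q = p\<close>.\<close>
  have le: "(dist p q)\<^sup>2 \<le> (dist x q)\<^sup>2 - (dist x p)\<^sup>2" if "q \<in> Fix F" for q
  proof (rule tendsto_le)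
    show "((\<lambda>l. (dist x q)\<^sup>2 - (dist x (resolvent F l x))\<^sup>2) \<longlongrightarrow>
        (dist x q)\<^sup>2 - (dist x p)\<^sup>2) at_top"
      and "((\<lambda>l. (dist (resolvent F l x) q)\<^sup>2) \<longlongrightarrow> (dist p q)\<^sup>2) at_top"
      by (intro tendsto_intros p)+
    show "\<forall>\<^sub>F l in at_top. (dist (resolvent F l x) q)\<^sup>2 \<le>
        (dist x q)\<^sup>2 - (dist x (resolvent F l x))\<^sup>2"
      using eventually_gt_at_top[of 0]
    proof eventually_elim
      case (elim l)
      show ?case
        using dist_resolvent_Fix_le[OF elim that] sq_dist_resolvent_le[OF elim] by linarith
    qed
  qed simp
  have "dist x p \<le> dist x q" if "q \<in> Fix F" for q
  proof (rule power2_le_imp_le)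
    show "(dist x p)\<^sup>2 \<le> (dist x q)\<^sup>2"
      using le[OF that] zero_le_power2[of "dist p q"] by linarith
  qed simp
  moreover have "Fix F \<noteq> {}" using pF by blast
  ultimately have "dist x p \<le> infdist x (Fix F)"
    by (simp add: infdist_notempty cINF_greatest)
  then have inf: "dist x p = infdist x (Fix F)"
    using infdist_le[OF pF, of x] by linarith
  have uniq: "q = p" if "q \<in> Fix F" "dist x q = infdist x (Fix F)" for q
    using le[OF that(1)] unfolding that(2) inf by simp
  show ?thesis
    unfolding metric_projection_def
    by (rule the_equality[symmetric], rule conjI[OF pF inf], rule uniq, erule conjunct1, erule conjunct2)
qed

text \<open>A bound on \<open>h\<close> along the sequence bounds it everywhere, since
  \<open>h\<close> is nondecreasing and the parameters \<open>l n\<close> exceed any given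
  one.\<close>

lemma resolvent_convergent:
  assumes l: "\<And>n::nat. 0 < l n" "filterlim l at_top sequentially"
    and b: "bounded (range (\<lambda>n. resolvent F (l n) x))"
  shows "\<exists>p. ((\<lambda>l. resolvent F l x) \<longlongrightarrow> p) at_top"
proof -
  define h where "h k = (dist x (resolvent F k x))\<^sup>2 / (k / (1 + k))" for k
  have incr: "(dist (resolvent F k x) (resolvent F m x))\<^sup>2 \<le> h m - h k" if "0 < k" "k \<le> m" for k m
    using dist_resolvents_le[OF that] by (simp add: h_def)
  obtain M where M: "\<And>n. dist x (resolvent F (l n) x) \<le> M"
    using b unfolding bounded_any_center[of _ x] by auto
  have bdd: "h k \<le> 2 * M\<^sup>2" if "0 < k" for k
  proof -
    \<comment> \<open>Here \<open>k \<le> l n\<close> serves monotonicity, while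
      \<open>1 \<le> l n\<close> makes the weight at least 1/2, whence the factor 2 in the
      bound.\<close>
    obtain n where n: "max k 1 \<le> l n"
      using l(2) unfolding filterlim_at_top eventually_sequentially by blast
    have "h k \<le> h (l n)"
      using incr[of k "l n"] n that zero_le_power2[of "dist (resolvent F k x) (resolvent F (l n) x)"]
      by linarith
    also have "\<dots> \<le> (dist x (resolvent F (l n) x))\<^sup>2 / (1 / 2)"
      unfolding h_def using n by (intro divide_left_mono) (auto simp: field_simps)
    also have "\<dots> \<le> 2 * M\<^sup>2"
      using power_mono[OF M, of n 2] by simp
    finally show ?thesis .
  qed
  show ?thesis
    by (rule tendsto_at_top_of_dist_le_increment[where h = h]) (fact incr bdd)+
qed

text \<open>Dropping the nonnegative left side of \<open>dist_resolvent_Fix_le\<close> confines the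
  curve to the closed ball about \<open>x\<close> of radius \<open>dist x q\<close>.\<close>

lemma resolvent_bounded:
  assumes "q \<in> Fix F"
  shows "bounded ((\<lambda>l. resolvent F l x) ` {0<..})"
proof -
  have "dist x (resolvent F l x) \<le> dist x q" if "0 < l" for l
  proof (rule power2_le_imp_le)
    show "(dist x (resolvent F l x))\<^sup>2 \<le> (dist x q)\<^sup>2"
      using dist_resolvent_Fix_le[OF that assms] sq_dist_resolvent_le[OF that]
        zero_le_power2[of "dist (resolvent F l x) q"] by linarith
  qed simp
  then show ?thesis unfolding bounded_any_center[of _ x] by auto
qed

end

theorem theorem1p4:
  fixes F :: "'a::hadamard_space \<Rightarrow> 'a" and x :: 'a
  assumes "nonexpansive F"
  shows "((\<exists>l::nat \<Rightarrow> real. (\<forall>n. 0 < l n) \<and> filterlim l at_top sequentially \<and>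
             bounded (range (\<lambda>n. resolvent F (l n) x)))
           \<longrightarrow> Fix F \<noteq> {} \<and>
               ((\<lambda>l. resolvent F l x) \<longlongrightarrow> metric_projection (Fix F) x) at_top) \<and>
         (Fix F \<noteq> {} \<longrightarrow> bounded ((\<lambda>l. resolvent F l x) ` {0<..}))"
proof (intro conjI impI)
  assume "\<exists>l::nat \<Rightarrow> real. (\<forall>n. 0 < l n) \<and> filterlim l at_top sequentially \<and>
    bounded (range (\<lambda>n. resolvent F (l n) x))"
  then obtain p where p: "((\<lambda>l. resolvent F l x) \<longlongrightarrow> p) at_top"
    using resolvent_convergent[OF assms] by metis
  show "Fix F \<noteq> {}"
    using limit_resolvent_in_Fix[OF assms p] by blast
  show "((\<lambda>l. resolvent F l x) \<longlongrightarrow> metric_projection (Fix F) x) at_top"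
    using p limit_resolvent_eq_projection[OF assms p] by simp
next
  assume "Fix F \<noteq> {}"
  then show "bounded ((\<lambda>l. resolvent F l x) ` {0<..})"
    using resolvent_bounded[OF assms] by blast
qed

end
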